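(* Let $R$ be a one-dimensional Noetherian domain and let $M$ be a nonzero $R$-module. Then $M$ is a top module in each of the following cases: (1) $M$ is weak multiplication; (2) for every prime ideal $\mathfrak p\in\mathrm{Spec}(R)$, $|\mathrm{Spec}_{\mathfrak p}(M)|\leq 1$, and $S_{(0)}(\mathbf{0})\subseteq \mathrm{rad}(\mathbf{0})$.
   Context: All rings are commutative with nonzero identity and all modules are unital. For a submodule $N$ of $M$, $(N:M)=\{r\in R\mid rM\subseteq N\}$. A submodule $P\neq M$ is prime if $rm\in P$ ($r\in R$, $m\in M$) implies $r\in (P:M)$ or $m\in P$; it is then called $\mathfrak p$-prime with $\mathfrak p=(P:M)$. $\mathrm{Spec}(M)$ is the set of prime submodules of $M$ and $\mathrm{Spec}_{\mathfrak p}(M)$ the set of $\mathfrak p$-prime submodules. $\mathrm{rad}(\mathbf 0)$ is the intersection of all prime submodules of $M$ (equal to $M$ if there are none). For a prime ideal $\mathfrak p$ and a submodule $N$ of $M$, $S_{\mathfrak p}(N)$ is the contraction of $N_{\mathfrak p}$ to $M$, i.e. the preimage of $N_{\mathfrak p}$ under $M\to M_{\mathfrak p}$; in particular $S_{(0)}(\mathbf 0)$ is the torsion submodule of $M$ when $R$ is a domain. $M$ is weak multiplication if $\mathrm{Spec}(M)=\emptyset$ or every prime submodule $N$ of $M$ has the form $N=IM$ for some ideal $I$ of $R$. A submodule of $M$ is semiprime if it is an intersection of prime submodules. A prime submodule $K$ of $M$ is extraordinary if whenever $N$ and $L$ are semiprime submodules of $M$ with $N\cap L\subseteq K$, then $N\subseteq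 K$ or $L\subseteq K$. $M$ is a top module if every prime submodule of $M$ is extraordinary. *)

theory Defs
  imports "HOL-Algebra.Algebra" "HOL-Library.Extended_Nat"
begin

text \<open>Krull dimension: the supremum of the lengths \<open>n\<close> of strictly increasing chains
  \<open>P 0 \<subset> P 1 \<subset> \<dots> \<subset> P n\<close> of prime ideals.\<close>

definition krull_dim :: "('a, 'r) ring_scheme \<Rightarrow> enat" where
  "krull_dim R = Sup {enat n | n. \<exists>P :: nat \<Rightarrow> 'a set.
     (\<forall>i\<le>n. primeideal (P i) R) \<and> (\<forall>i<n. P i \<subset> P (Suc i))}"

definition module_colon ::
  "('a, 'r) ring_scheme \<Rightarrow> ('a, 'b, 'm) module_scheme \<Rightarrow> 'b set \<Rightarrow> 'a set" where
  "module_colon R M N = {r \<in> carrier R. \<forall>m \<in> carrier M. r \<odot>\<^bsub>M\<^esub> m \<in> N}"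

definition prime_submodule ::
  "('a, 'r) ring_scheme \<Rightarrow> ('a, 'b, 'm) module_scheme \<Rightarrow> 'b set \<Rightarrow> bool" where
  "prime_submodule R M P \<longleftrightarrow> submodule P R M \<and> P \<noteq> carrier M \<and>
     (\<forall>r \<in> carrier R. \<forall>m \<in> carrier M. r \<odot>\<^bsub>M\<^esub> m \<in> P \<longrightarrow> r \<in> module_colon R M P \<or> m \<in> P)"

definition Spec_mod ::
  "('a, 'r) ring_scheme \<Rightarrow> ('a, 'b, 'm) module_scheme \<Rightarrow> 'b set set" where
  "Spec_mod R M = {P. prime_submodule R M P}"

definition Spec_mod_at ::
  "('a, 'r) ring_scheme \<Rightarrow> ('a, 'b, 'm) module_scheme \<Rightarrow> 'a set \<Rightarrow> 'b set set" where
  "Spec_mod_at R M p = {P \<in> Spec_mod R M. module_colon R M P = p}"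

text \<open>Intersecting with the carrier makes the intersection of the empty family equal to
  \<open>M\<close>; submodules are subsets of the carrier, so this changes nothing for nonempty families.\<close>

definition rad_zero ::
  "('a, 'r) ring_scheme \<Rightarrow> ('a, 'b, 'm) module_scheme \<Rightarrow> 'b set" where
  "rad_zero R M = carrier M \<inter> \<Inter>(Spec_mod R M)"

definition semiprime_submodule ::
  "('a, 'r) ring_scheme \<Rightarrow> ('a, 'b, 'm) module_scheme \<Rightarrow> 'b set \<Rightarrow> bool" where
  "semiprime_submodule R M N \<longleftrightarrow> (\<exists>F \<subseteq> Spec_mod R M. N = carrier M \<inter> \<Inter>F)"

text \<open>The product \<open>I M\<close>: the submodule generated by all \<open>a \<odot> m\<close> with \<open>a \<in> I\<close>.\<close>

definition ideal_smult ::
  "('a, 'r) ring_scheme \<Rightarrow> ('a, 'b, 'm) module_scheme \<Rightarrow> 'a set \<Rightarrow> 'b set" where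
  "ideal_smult R M I =
     \<Inter>{N. submodule N R M \<and> {a \<odot>\<^bsub>M\<^esub> m | a m. a \<in> I \<and> m \<in> carrier M} \<subseteq> N}"

definition weak_multiplication_module ::
  "('a, 'r) ring_scheme \<Rightarrow> ('a, 'b, 'm) module_scheme \<Rightarrow> bool" where
  "weak_multiplication_module R M \<longleftrightarrow> Spec_mod R M = {} \<or>
     (\<forall>N \<in> Spec_mod R M. \<exists>I. ideal I R \<and> N = ideal_smult R M I)"

text \<open>The localization of \<open>M\<close> at \<open>p\<close> is the quotient of \<open>M \<times> (R - p)\<close> by
  \<open>(m, s) \<sim> (m', s')\<close> iff \<open>u (s' m - s m') = 0\<close> for some \<open>u \<in> R - p\<close>.  Only its
  underlying set is needed for contractions.  For a submodule \<open>N\<close>,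
  \<open>localize_submodule R M p N\<close> is \<open>N\<close> localized at \<open>p\<close>, viewed as the set of
  fractions \<open>n/s\<close> inside the localization of \<open>M\<close>.\<close>

definition localization_rel ::
  "('a, 'r) ring_scheme \<Rightarrow> ('a, 'b, 'm) module_scheme \<Rightarrow> 'a set \<Rightarrow> (('b \<times> 'a) \<times> ('b \<times> 'a)) set" where
  "localization_rel R M p = {((m, s), (m', s')).
     m \<in> carrier M \<and> s \<in> carrier R - p \<and> m' \<in> carrier M \<and> s' \<in> carrier R - p \<and>
     (\<exists>u \<in> carrier R - p. u \<odot>\<^bsub>M\<^esub> (s' \<odot>\<^bsub>M\<^esub> m \<ominus>\<^bsub>M\<^esub> s \<odot>\<^bsub>M\<^esub> m') = \<zero>\<^bsub>M\<^esub>)}"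

definition localization_frac ::
  "('a, 'r) ring_scheme \<Rightarrow> ('a, 'b, 'm) module_scheme \<Rightarrow> 'a set \<Rightarrow> 'b \<Rightarrow> 'a \<Rightarrow> ('b \<times> 'a) set" where
  "localization_frac R M p m s = localization_rel R M p `` {(m, s)}"

definition localize_submodule ::
  "('a, 'r) ring_scheme \<Rightarrow> ('a, 'b, 'm) module_scheme \<Rightarrow> 'a set \<Rightarrow> 'b set \<Rightarrow> ('b \<times> 'a) set set" where
  "localize_submodule R M p N = {localization_frac R M p n s | n s. n \<in> N \<and> s \<in> carrier R - p}"

definition contraction ::
  "('a, 'r) ring_scheme \<Rightarrow> ('a, 'b, 'm) module_scheme \<Rightarrow> 'a set \<Rightarrow> 'b set \<Rightarrow> 'b set" where
  "contraction R M p N =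
     {m \<in> carrier M. localization_frac R M p m \<one>\<^bsub>R\<^esub> \<in> localize_submodule R M p N}"

definition extraordinary_submodule ::
  "('a, 'r) ring_scheme \<Rightarrow> ('a, 'b, 'm) module_scheme \<Rightarrow> 'b set \<Rightarrow> bool" where
  "extraordinary_submodule R M K \<longleftrightarrow> prime_submodule R M K \<and>
     (\<forall>N L. semiprime_submodule R M N \<and> semiprime_submodule R M L \<and> N \<inter> L \<subseteq> K
        \<longrightarrow> N \<subseteq> K \<or> L \<subseteq> K)"

definition top_module ::
  "('a, 'r) ring_scheme \<Rightarrow> ('a, 'b, 'm) module_scheme \<Rightarrow> bool" where
  "top_module R M \<longleftrightarrow> (\<forall>P \<in> Spec_mod R M. extraordinary_submodule R M P)"

end

theory Submission
  imports Defs
begin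

text \<open>Call \<open>N\<close> large if every element of \<open>M\<close> has a nonzero multiple in \<open>N\<close>. Both hypotheses imply
  that a prime submodule is determined by its colon ideal and that the prime submodule with colon
  ideal zero, if there is one, lies in every prime submodule. The elements with a nonzero
  multiple in a submodule \<open>N\<close> form either \<open>M\<close> or a prime submodule with colon ideal zero; so if \<open>N\<close>
  is not contained in a prime \<open>K\<close>, then \<open>N\<close> is large. Let moreover \<open>N\<close> be the intersection of
  primes \<open>P\<close>, let \<open>p = (K : M)\<close> and let \<open>a y \<in> N\<close> with \<open>a \<noteq> 0\<close>. No \<open>(P : M)\<close> lies in \<open>p\<close>. Those \<open>P\<close> with
  \<open>a \<notin> (P : M)\<close> contain \<open>y\<close>, and the others have only finitely many colon ideals, because a nonzero
  element of \<open>R\<close> lies in only finitely many primes. Multiplying one element of each of these colon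
  ideals outside \<open>p\<close> gives \<open>s \<notin> p\<close> with \<open>s y \<in> N\<close>. If \<open>L\<close> is another such intersection, with
  \<open>t y \<in> L\<close>, \<open>t \<notin> p\<close>, then \<open>s t y \<in> N \<inter> L\<close>, which for \<open>y \<notin> K\<close> is not in \<open>K\<close>.\<close>

lemma (in domain) primeideal_below_cases:
  assumes "krull_dim R \<le> 1" "primeideal p R" "primeideal q R" "p \<subseteq> q"
  shows "p = {\<zero>} \<or> p = q"
proof (rule ccontr)
  assume contra: "\<not> ?thesis"
  have "\<zero> \<in> p"
    using assms(2) by (simp add: additive_subgroup.zero_closed ideal.axioms(1) primeideal.axioms(1))
  then have chain: "{\<zero>} \<subset> p" "p \<subset> q"
    using contra assms(4) by auto
  define P where "P i = (if i = 0 then {\<zero>} else if i = 1 then p else q)" for i :: nat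
  have "\<forall>i\<le>2. primeideal (P i) R"
    by (simp add: P_def assms zeroprimeideal)
  moreover have "\<forall>i<2. P i \<subset> P (Suc i)"
    using chain by (auto simp: P_def less_Suc_eq numeral_2_eq_2)
  ultimately have "enat 2 \<le> krull_dim R"
    unfolding krull_dim_def by (intro Sup_upper) blast
  then have "enat 2 \<le> 1"
    using assms(1) by (rule order_trans)
  then show False
    by (simp add: one_enat_def)
qed

lemma (in noetherian_ring) noetherian_ideal_induct:
  assumes "ideal I R"
    and step: "\<And>I. \<lbrakk>ideal I R; \<And>J. \<lbrakk>ideal J R; I \<subset> J\<rbrakk> \<Longrightarrow> Q J\<rbrakk> \<Longrightarrow> Q I"
  shows "Q I"
proof (rule ccontr)
  assume "\<not> Q I"
  define S where "S = {J. ideal J R \<and> \<not> Q J}"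
  have "\<exists>J\<in>S. \<forall>K\<in>S. J \<subseteq> K \<longrightarrow> K = J"
  proof (rule subset_Zorn)
    fix C assume C: "subset.chain S C"
    show "\<exists>U\<in>S. \<forall>K\<in>C. K \<subseteq> U"
    proof (cases "C = {}")
      case True
      then show ?thesis using assms(1) \<open>\<not> Q I\<close> by (auto simp: S_def)
    next
      case False
      have "subset.chain {I. ideal I R} C"
        using C by (auto simp: S_def pred_on.chain_def)
      then have "\<Union>C \<in> C"
        using False by (rule ideal_chain_is_trivial[rotated])
      moreover have "C \<subseteq> S"
        using C by (auto simp: pred_on.chain_def)
      ultimately show ?thesis by blast
    qed
  qed
  then obtain J where "J \<in> S" and max: "\<And>K. K \<in> S \<Longrightarrow> J \<subseteq> K \<Longrightarrow> K = J"
    by blast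
  have "Q J"
  proof (rule step)
    show "ideal J R"
      using \<open>J \<in> S\<close> by (simp add: S_def)
    show "Q K" if "ideal K R" "J \<subset> K" for K
      using max[of K] that by (auto simp: S_def)
  qed
  with \<open>J \<in> S\<close> show False
    by (simp add: S_def)
qed

lemma (in cring) primes_above_finite_family:
  assumes "noetherian_ring R" "ideal I R"
  shows "\<exists>S. finite S \<and> (\<forall>p\<in>S. primeideal p R \<and> I \<subseteq> p) \<and>
    (\<forall>q. primeideal q R \<and> I \<subseteq> q \<longrightarrow> (\<exists>p\<in>S. p \<subseteq> q))"
    (is "\<exists>S. ?above I S")
  using assms
proof (induction I rule: noetherian_ring.noetherian_ideal_induct[consumes 2])
  case (1 I)
  interpret I: ideal I R by fact
  consider "primeideal I R" | "I = carrier R"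
    | a b where "a \<in> carrier R" "b \<in> carrier R" "a \<otimes> b \<in> I" "a \<notin> I" "b \<notin> I"
    using I.primeidealCD[OF is_cring] by blast
  then show ?case
  proof cases
    case 1
    then have "?above I {I}" by auto
    then show ?thesis ..
  next
    case 2
    then have "\<not> I \<subseteq> q" if "primeideal q R" for q
      using primeideal.I_notcarr[OF that] additive_subgroup.a_subset[of q R]
        ideal.axioms(1)[OF primeideal.axioms(1)[OF that]] by blast
    then have "?above I {}" by auto
    then show ?thesis ..
  next
    case (3 a b)
    define J where "J c = Idl (insert c I)" for c
    have sub: "insert c I \<subseteq> carrier R" if "c \<in> carrier R" for c
      using that I.a_subset by blast
    have ideal_J: "ideal (J c) R" if "c \<in> carrier R" for c
      unfolding J_def by (rule genideal_ideal[OF sub[OF that]])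
    have J_above: "insert c I \<subseteq> J c" if "c \<in> carrier R" for c
      unfolding J_def by (rule genideal_self[OF sub[OF that]])
    obtain A where A: "?above (J a) A"
      using "1.IH"[OF ideal_J[of a]] J_above[of a] 3 by blast
    obtain B where B: "?above (J b) B"
      using "1.IH"[OF ideal_J[of b]] J_above[of b] 3 by blast
    have "\<exists>p\<in>A \<union> B. p \<subseteq> q" if q: "primeideal q R" "I \<subseteq> q" for q
    proof -
      have "a \<in> q \<or> b \<in> q"
        using primeideal.I_prime[OF q(1)] q(2) 3 by blast
      then have "J a \<subseteq> q \<or> J b \<subseteq> q"
        unfolding J_def using genideal_minimal[OF primeideal.axioms(1)[OF q(1)]] q(2) by blast
      moreover have "\<exists>p\<in>A. p \<subseteq> q" if "J a \<subseteq> q"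
        using A q(1) that by simp
      moreover have "\<exists>p\<in>B. p \<subseteq> q" if "J b \<subseteq> q"
        using B q(1) that by simp
      ultimately show ?thesis by blast
    qed
    moreover have "I \<subseteq> J a" "I \<subseteq> J b"
      using J_above 3(1,2) by simp_all
    then have "\<forall>p\<in>A \<union> B. primeideal p R \<and> I \<subseteq> p"
      using A B by (meson UnE order_trans)
    ultimately have "?above I (A \<union> B)"
      using A B by simp
    then show ?thesis ..
  qed
qed

lemma (in noetherian_domain) finite_primes_containing:
  assumes "krull_dim R \<le> 1" "a \<in> carrier R" "a \<noteq> \<zero>"
  shows "finite {p. primeideal p R \<and> a \<in> p}"
proof -
  obtain S where S: "finite S" "\<forall>p\<in>S. primeideal p R \<and> PIdl a \<subseteq> p"
    "\<forall>q. primeideal q R \<and> PIdl a \<subseteq> q \<longrightarrow> (\<exists>p\<in>S. p \<subseteq> q)"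
    using primes_above_finite_family[OF noetherian_ring_axioms cgenideal_ideal[OF assms(2)]]
    by (elim exE conjE) (rule that)
  have "q \<in> S" if q: "primeideal q R" "a \<in> q" for q
  proof -
    have "PIdl a \<subseteq> q"
      using q by (intro cgenideal_minimal primeideal.axioms(1))
    then obtain p where p: "p \<in> S" "p \<subseteq> q"
      using S(3) q(1) by blast
    then have "a \<in> p"
      using S(2) cgenideal_self[OF assms(2)] by blast
    moreover have "p = {\<zero>} \<or> p = q"
      using S(2) p by (intro primeideal_below_cases[OF assms(1) _ q(1)]) simp_all
    ultimately show ?thesis
      using p(1) assms(3) by blast
  qed
  then show ?thesis
    by (intro finite_subset[OF _ S(1)]) blast
qed

lemma (in cring) prime_avoiding_element:
  assumes "primeideal p R" "finite B" "\<And>q. q \<in> B \<Longrightarrow> ideal q R \<and> \<not> q \<subseteq> p"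
  shows "\<exists>s \<in> carrier R - p. \<forall>q\<in>B. s \<in> q"
  using assms(2,3)
proof (induction B)
  case empty
  then show ?case
    using additive_subgroup.a_subset[OF ideal.axioms(1)[OF primeideal.axioms(1)[OF assms(1)]]]
      primeideal.I_notcarr[OF assms(1)] by blast
next
  case (insert q B)
  then obtain s where s: "s \<in> carrier R - p" "\<And>q. q \<in> B \<Longrightarrow> s \<in> q"
    by auto
  have "ideal q R"
    using insert.prems by simp
  obtain t where t: "t \<in> q" "t \<notin> p"
    using insert.prems by blast
  have tR: "t \<in> carrier R"
    by (rule ideal.Icarr[OF \<open>ideal q R\<close> t(1)])
  have "s \<otimes> t \<in> carrier R - p"
    using primeideal.I_prime[OF assms(1), of s t] s(1) t(2) tR by auto
  moreover have "s \<otimes> t \<in> q"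
    using s(1) by (intro ideal.I_l_closed[OF \<open>ideal q R\<close> t(1)]) simp
  moreover have "s \<otimes> t \<in> q'" if "q' \<in> B" for q'
    using insert.prems that by (intro ideal.I_r_closed[OF _ s(2)[OF that] tR]) simp
  ultimately show ?case by (intro bexI[of _ "s \<otimes> t"]) simp_all
qed

context module
begin

lemma prime_submoduleD:
  assumes "P \<in> Spec_mod R M"
  shows "submodule P R M" "P \<subseteq> carrier M" "P \<noteq> carrier M"
    "\<And>r m. \<lbrakk>r \<in> carrier R; m \<in> carrier M; r \<odot>\<^bsub>M\<^esub> m \<in> P\<rbrakk> \<Longrightarrow> r \<in> module_colon R M P \<or> m \<in> P"
  using assms submoduleE(1) by (auto simp: Spec_mod_def prime_submodule_def)

lemma submodule_zero: "submodule N R M \<Longrightarrow> \<zero>\<^bsub>M\<^esub> \<in> N"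
  using submoduleE(1,2,4)[of N] smult_l_null R.zero_closed by (metis ex_in_conv subsetD)

lemma ideal_module_colon:
  assumes "submodule N R M"
  shows "ideal (module_colon R M N) R"
proof (rule idealI[OF R.ring_axioms])
  note N = submoduleE[OF assms] submodule_zero[OF assms]
  show "subgroup (module_colon R M N) (add_monoid R)"
  proof (rule R.add.subgroupI)
    show "module_colon R M N \<noteq> {}"
      using N by (auto simp: module_colon_def intro!: exI[of _ \<zero>])
    show "\<ominus> r \<in> module_colon R M N" if "r \<in> module_colon R M N" for r
      using that N(3) by (auto simp: module_colon_def smult_l_minus)
  qed (use N in \<open>auto simp: module_colon_def smult_l_distr\<close>)
  fix r x assume *: "r \<in> module_colon R M N" "x \<in> carrier R"
  then show "x \<otimes> r \<in> module_colon R M N"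
    using N(4) by (auto simp: module_colon_def smult_assoc1)
  with * show "r \<otimes> x \<in> module_colon R M N"
    by (simp add: module_colon_def R.m_comm)
qed

lemma primeideal_module_colon:
  assumes "P \<in> Spec_mod R M"
  shows "primeideal (module_colon R M P) R"
proof (rule primeidealI)
  note P = prime_submoduleD[OF assms]
  show "ideal (module_colon R M P) R"
    by (rule ideal_module_colon[OF P(1)])
  show "cring R"
    by (rule R.is_cring)
  show "carrier R \<noteq> module_colon R M P"
  proof
    assume "carrier R = module_colon R M P"
    then have "\<one> \<in> module_colon R M P" by blast
    then show False using P(2,3) by (auto simp: module_colon_def)
  qed
  fix a b assume ab: "a \<in> carrier R" "b \<in> carrier R" "a \<otimes> b \<in> module_colon R M P"
  then have "a \<odot>\<^bsub>M\<^esub> (b \<odot>\<^bsub>M\<^esub> m) \<in> P" if "m \<in> carrier M" for m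
    using that by (auto simp: module_colon_def smult_assoc1)
  then show "a \<in> module_colon R M P \<or> b \<in> module_colon R M P"
    using P(4)[OF ab(1)] ab(2) unfolding module_colon_def[of R M P] by blast
qed

lemma saturation_submodule:
  assumes "domain R" "submodule N R M"
  shows "submodule {m \<in> carrier M. \<exists>a \<in> carrier R - {\<zero>}. a \<odot>\<^bsub>M\<^esub> m \<in> N} R M" (is "submodule ?W R M")
proof -
  interpret domain R by fact
  note N = submoduleE[OF assms(2)] submodule_zero[OF assms(2)]
  show ?thesis
  proof (rule submoduleI)
    show "\<zero>\<^bsub>M\<^esub> \<in> ?W"
      using N by (auto intro!: bexI[of _ \<one>])
  next
    fix m assume "m \<in> ?W"
    then show "\<ominus>\<^bsub>M\<^esub> m \<in> ?W"
      using N(3) by (auto simp: smult_r_minus)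
  next
    fix m n assume "m \<in> ?W" "n \<in> ?W"
    then obtain a b where *: "m \<in> carrier M" "n \<in> carrier M" "a \<in> carrier R" "b \<in> carrier R"
      "a \<noteq> \<zero>" "b \<noteq> \<zero>" "a \<odot>\<^bsub>M\<^esub> m \<in> N" "b \<odot>\<^bsub>M\<^esub> n \<in> N"
      by blast
    have "(a \<otimes> b) \<odot>\<^bsub>M\<^esub> (m \<oplus>\<^bsub>M\<^esub> n) = b \<odot>\<^bsub>M\<^esub> (a \<odot>\<^bsub>M\<^esub> m) \<oplus>\<^bsub>M\<^esub> a \<odot>\<^bsub>M\<^esub> (b \<odot>\<^bsub>M\<^esub> n)"
      using * by (simp add: smult_r_distr smult_assoc1[symmetric] R.m_comm)
    also have "\<dots> \<in> N"
      by (intro N(5) N(4)[OF *(4,7)] N(4)[OF *(3,8)])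
    finally show "m \<oplus>\<^bsub>M\<^esub> n \<in> ?W"
      using * by (auto intro!: bexI[of _ "a \<otimes> b"] simp: integral_iff)
  next
    fix r m assume r: "r \<in> carrier R" and "m \<in> ?W"
    then obtain a where *: "m \<in> carrier M" "a \<in> carrier R" "a \<noteq> \<zero>" "a \<odot>\<^bsub>M\<^esub> m \<in> N"
      by blast
    have "a \<odot>\<^bsub>M\<^esub> (r \<odot>\<^bsub>M\<^esub> m) = r \<odot>\<^bsub>M\<^esub> (a \<odot>\<^bsub>M\<^esub> m)"
      using * r by (simp add: smult_assoc1[symmetric] R.m_comm)
    then show "r \<odot>\<^bsub>M\<^esub> m \<in> ?W"
      using *(1-3) r N(4)[OF r *(4)] by (auto intro!: bexI[of _ a])
  qed blast
qed

lemma saturation_prime: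
  assumes "domain R" "submodule N R M"
    and W: "W = {m \<in> carrier M. \<exists>a \<in> carrier R - {\<zero>}. a \<odot>\<^bsub>M\<^esub> m \<in> N}" "W \<noteq> carrier M"
  shows "W \<in> Spec_mod R M" "module_colon R M W = {\<zero>}"
proof -
  interpret domain R by fact
  have sub: "submodule W R M"
    unfolding W(1) by (rule saturation_submodule[OF assms(1,2)])
  have sat: "m \<in> W" if r: "r \<in> carrier R" "r \<noteq> \<zero>" "m \<in> carrier M" "r \<odot>\<^bsub>M\<^esub> m \<in> W" for r m
  proof -
    obtain a where a: "a \<in> carrier R" "a \<noteq> \<zero>" "a \<odot>\<^bsub>M\<^esub> (r \<odot>\<^bsub>M\<^esub> m) \<in> N"
      using r(4) unfolding W(1) by blast
    then show ?thesis
      unfolding W(1) using r by (auto intro!: bexI[of _ "a \<otimes> r"] simp: smult_assoc1 integral_iff)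
  qed
  have "r = \<zero>" if "r \<in> module_colon R M W" for r
    using that sat W(2) submoduleE(1)[OF sub] by (auto simp: module_colon_def)
  moreover have "\<zero> \<in> module_colon R M W"
    using submodule_zero[OF sub] by (simp add: module_colon_def)
  ultimately show colon: "module_colon R M W = {\<zero>}"
    by blast
  show "W \<in> Spec_mod R M"
    using sub W(2) sat by (auto simp: Spec_mod_def prime_submodule_def colon)
qed

lemma submodule_semiprime:
  assumes "F \<subseteq> Spec_mod R M"
  shows "submodule (carrier M \<inter> \<Inter>F) R M"
proof -
  have "submodule P R M" if "P \<in> F" for P
    using assms that prime_submoduleD(1) by blast
  note F = submoduleE(3-5)[OF this] submodule_zero[OF this]
  show ?thesis
    by (rule submoduleI) (auto intro: F)
qed

lemma multiplier_into_semiprime: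
  assumes R: "noetherian_domain R" "krull_dim R \<le> 1"
    and unique: "\<And>P Q. \<lbrakk>P \<in> Spec_mod R M; Q \<in> Spec_mod R M;
        module_colon R M P = module_colon R M Q\<rbrakk> \<Longrightarrow> P = Q"
    and least: "\<And>P Q. \<lbrakk>P \<in> Spec_mod R M; Q \<in> Spec_mod R M;
        module_colon R M P = {\<zero>}\<rbrakk> \<Longrightarrow> P \<subseteq> Q"
    and K: "K \<in> Spec_mod R M" and N: "semiprime_submodule R M N" "\<not> N \<subseteq> K"
    and y: "y \<in> carrier M"
  shows "\<exists>s \<in> carrier R - module_colon R M K. s \<odot>\<^bsub>M\<^esub> y \<in> N"
proof -
  interpret noetherian_domain R by fact
  obtain F where F: "F \<subseteq> Spec_mod R M" and NF: "N = carrier M \<inter> \<Inter>F"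
    using N(1) unfolding semiprime_submodule_def by blast
  have subN: "submodule N R M"
    unfolding NF by (rule submodule_semiprime[OF F])
  define W where "W = {m \<in> carrier M. \<exists>a \<in> carrier R - {\<zero>}. a \<odot>\<^bsub>M\<^esub> m \<in> N}"
  have "N \<subseteq> W"
    unfolding W_def NF by (auto intro!: bexI[of _ \<one>])
  have "W = carrier M"
  proof (rule ccontr)
    assume "W \<noteq> carrier M"
    then have "W \<subseteq> K"
      by (intro least K saturation_prime[OF domain_axioms subN W_def])
    with \<open>N \<subseteq> W\<close> N(2) show False by blast
  qed
  then obtain a where a: "a \<in> carrier R" "a \<noteq> \<zero>" "a \<odot>\<^bsub>M\<^esub> y \<in> N"
    using y unfolding W_def by blast
  define B where "B = {q \<in> module_colon R M ` F. a \<in> q}"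
  have "finite B"
    by (rule finite_subset[OF _ finite_primes_containing[OF R(2) a(1,2)]])
      (use F primeideal_module_colon in \<open>auto simp: B_def\<close>)
  have "\<not> module_colon R M P \<subseteq> module_colon R M K" if "P \<in> F" for P
  proof
    assume sub: "module_colon R M P \<subseteq> module_colon R M K"
    have P: "P \<in> Spec_mod R M"
      using F that by blast
    have "P \<subseteq> K"
      using primeideal_below_cases[OF R(2) primeideal_module_colon[OF P] primeideal_module_colon[OF K] sub]
        least[OF P K] unique[OF P K] by blast
    then show False
      using N(2) NF that by blast
  qed
  then have B_avoid: "ideal q R \<and> \<not> q \<subseteq> module_colon R M K" if "q \<in> B" for q
    using that F primeideal.axioms(1)[OF primeideal_module_colon] by (auto simp: B_def)
  obtain s where s: "s \<in> carrier R - module_colon R M K" "\<And>q. q \<in> B \<Longrightarrow> s \<in> q"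
    using prime_avoiding_element[OF primeideal_module_colon[OF K] \<open>finite B\<close> B_avoid] by blast
  have "s \<odot>\<^bsub>M\<^esub> y \<in> P" if "P \<in> F" for P
  proof (cases "a \<in> module_colon R M P")
    case True
    then have "s \<in> module_colon R M P"
      using that by (intro s(2)) (simp add: B_def)
    then show ?thesis
      using y by (simp add: module_colon_def)
  next
    case False
    have P: "P \<in> Spec_mod R M"
      using F that by blast
    have "a \<odot>\<^bsub>M\<^esub> y \<in> P"
      using a(3) that NF by simp
    then have "y \<in> P"
      using prime_submoduleD(4)[OF P a(1) y] False by simp
    then show ?thesis
      using submoduleE(4)[OF prime_submoduleD(1)[OF P]] s(1) by simp
  qed
  then have "s \<odot>\<^bsub>M\<^esub> y \<in> N"
    using s(1) y NF by simp
  with s(1) show ?thesis by blast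
qed

lemma top_module_criterion:
  assumes "noetherian_domain R" "krull_dim R \<le> 1"
    and "\<And>P Q. \<lbrakk>P \<in> Spec_mod R M; Q \<in> Spec_mod R M;
        module_colon R M P = module_colon R M Q\<rbrakk> \<Longrightarrow> P = Q"
    and "\<And>P Q. \<lbrakk>P \<in> Spec_mod R M; Q \<in> Spec_mod R M;
        module_colon R M P = {\<zero>}\<rbrakk> \<Longrightarrow> P \<subseteq> Q"
  shows "top_module R M"
  unfolding top_module_def extraordinary_submodule_def
proof (intro ballI conjI allI impI)
  fix K assume K: "K \<in> Spec_mod R M"
  then show "prime_submodule R M K"
    by (simp add: Spec_mod_def)
  fix N L assume *: "semiprime_submodule R M N \<and> semiprime_submodule R M L \<and> N \<inter> L \<subseteq> K"
  show "N \<subseteq> K \<or> L \<subseteq> K"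
  proof (rule ccontr)
    assume contra: "\<not> (N \<subseteq> K \<or> L \<subseteq> K)"
    have sub: "submodule N R M" "submodule L R M"
      using * submodule_semiprime by (auto simp: semiprime_submodule_def)
    obtain y where y: "y \<in> carrier M" "y \<notin> K"
      using prime_submoduleD(2,3)[OF K] by blast
    obtain s where s: "s \<in> carrier R" "s \<notin> module_colon R M K" "s \<odot>\<^bsub>M\<^esub> y \<in> N"
      using multiplier_into_semiprime[OF assms K _ _ y(1)] * contra by blast
    obtain t where t: "t \<in> carrier R" "t \<notin> module_colon R M K" "t \<odot>\<^bsub>M\<^esub> y \<in> L"
      using multiplier_into_semiprime[OF assms K _ _ y(1)] * contra by blast
    have "t \<odot>\<^bsub>M\<^esub> (s \<odot>\<^bsub>M\<^esub> y) = s \<odot>\<^bsub>M\<^esub> (t \<odot>\<^bsub>M\<^esub> y)"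
      using s t y by (simp add: smult_assoc1[symmetric] R.m_comm)
    then have "s \<odot>\<^bsub>M\<^esub> (t \<odot>\<^bsub>M\<^esub> y) \<in> N \<inter> L"
      using submoduleE(4)[OF sub(1) t(1) s(3)] submoduleE(4)[OF sub(2) s(1) t(3)] by simp
    then have "s \<odot>\<^bsub>M\<^esub> (t \<odot>\<^bsub>M\<^esub> y) \<in> K"
      using * by (metis subsetD)
    then have "t \<odot>\<^bsub>M\<^esub> y \<in> K"
      using prime_submoduleD(4)[OF K s(1) smult_closed[OF t(1) y(1)]] s(2) by simp
    then show False
      using prime_submoduleD(4)[OF K t(1) y(1)] t(2) y(2) by simp
  qed
qed

lemma ideal_smult_module_colon:
  assumes "P \<in> Spec_mod R M" "ideal I R" "P = ideal_smult R M I"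
  shows "P = ideal_smult R M (module_colon R M P)"
proof
  have "r \<odot>\<^bsub>M\<^esub> m \<in> ideal_smult R M I" if "r \<in> I" "m \<in> carrier M" for r m
    using that by (auto simp: ideal_smult_def)
  then have "I \<subseteq> module_colon R M P"
    using assms(3) ideal.Icarr[OF assms(2)] by (auto simp: module_colon_def)
  then have "ideal_smult R M I \<subseteq> ideal_smult R M (module_colon R M P)"
    unfolding ideal_smult_def by (intro Inter_anti_mono) blast
  then show "P \<subseteq> ideal_smult R M (module_colon R M P)"
    using assms(3) by simp
  show "ideal_smult R M (module_colon R M P) \<subseteq> P"
    using prime_submoduleD(1)[OF assms(1)] by (auto simp: ideal_smult_def module_colon_def)
qed

lemma torsion_in_contraction:
  assumes "domain R" "m \<in> carrier M" "a \<in> carrier R" "a \<noteq> \<zero>" "a \<odot>\<^bsub>M\<^esub> m = \<zero>\<^bsub>M\<^esub>"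
  shows "m \<in> contraction R M {\<zero>} {\<zero>\<^bsub>M\<^esub>}"
proof -
  interpret domain R by fact
  have absorb: "(a \<otimes> u) \<odot>\<^bsub>M\<^esub> (s \<odot>\<^bsub>M\<^esub> m \<ominus>\<^bsub>M\<^esub> n) = \<ominus>\<^bsub>M\<^esub> ((a \<otimes> u) \<odot>\<^bsub>M\<^esub> n)"
    if "u \<in> carrier R" "s \<in> carrier R" "n \<in> carrier M" for u s n
  proof -
    have "(a \<otimes> u) \<odot>\<^bsub>M\<^esub> (s \<odot>\<^bsub>M\<^esub> m) = (u \<otimes> s) \<odot>\<^bsub>M\<^esub> (a \<odot>\<^bsub>M\<^esub> m)"
      using that assms(2,3) by (simp add: smult_assoc1[symmetric] R.m_ac)
    then show ?thesis
      using that assms(2,3,5) by (simp add: a_minus_def smult_r_distr smult_r_minus)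
  qed
  have "((m, \<one>), (n, s)) \<in> localization_rel R M {\<zero>} \<longleftrightarrow>
      ((\<zero>\<^bsub>M\<^esub>, \<one>), (n, s)) \<in> localization_rel R M {\<zero>}" for n s
  proof (cases "n \<in> carrier M \<and> s \<in> carrier R - {\<zero>}")
    case True
    then have ns: "n \<in> carrier M" "s \<in> carrier R" by auto
    have zero: "u \<odot>\<^bsub>M\<^esub> (s \<odot>\<^bsub>M\<^esub> \<zero>\<^bsub>M\<^esub> \<ominus>\<^bsub>M\<^esub> n) = \<ominus>\<^bsub>M\<^esub> (u \<odot>\<^bsub>M\<^esub> n)" if "u \<in> carrier R" for u
      using that ns by (simp add: a_minus_def smult_r_minus)
    have kill: "(a \<otimes> u) \<odot>\<^bsub>M\<^esub> z = \<zero>\<^bsub>M\<^esub>" if "u \<in> carrier R" "z \<in> carrier M" "u \<odot>\<^bsub>M\<^esub> z = \<zero>\<^bsub>M\<^esub>" for u z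
      using that assms(3) by (simp add: smult_assoc1)
    have au: "a \<otimes> u \<in> carrier R - {\<zero>}" if "u \<in> carrier R - {\<zero>}" for u
      using that assms(3,4) by (simp add: integral_iff)
    have "(\<exists>u\<in>carrier R - {\<zero>}. u \<odot>\<^bsub>M\<^esub> (s \<odot>\<^bsub>M\<^esub> m \<ominus>\<^bsub>M\<^esub> n) = \<zero>\<^bsub>M\<^esub>) \<longleftrightarrow>
        (\<exists>u\<in>carrier R - {\<zero>}. u \<odot>\<^bsub>M\<^esub> (s \<odot>\<^bsub>M\<^esub> \<zero>\<^bsub>M\<^esub> \<ominus>\<^bsub>M\<^esub> n) = \<zero>\<^bsub>M\<^esub>)" (is "?l \<longleftrightarrow> ?r")
    proof
      assume ?l
      then obtain u where u: "u \<in> carrier R - {\<zero>}" "u \<odot>\<^bsub>M\<^esub> (s \<odot>\<^bsub>M\<^esub> m \<ominus>\<^bsub>M\<^esub> n) = \<zero>\<^bsub>M\<^esub>" by blast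
      then have "(a \<otimes> u) \<odot>\<^bsub>M\<^esub> (s \<odot>\<^bsub>M\<^esub> \<zero>\<^bsub>M\<^esub> \<ominus>\<^bsub>M\<^esub> n) = \<zero>\<^bsub>M\<^esub>"
        using kill[of u "s \<odot>\<^bsub>M\<^esub> m \<ominus>\<^bsub>M\<^esub> n"] absorb[of u s n] zero[of "a \<otimes> u"] ns assms(2,3) by simp
      then show ?r using au u(1) by blast
    next
      assume ?r
      then obtain u where u: "u \<in> carrier R - {\<zero>}" "u \<odot>\<^bsub>M\<^esub> (s \<odot>\<^bsub>M\<^esub> \<zero>\<^bsub>M\<^esub> \<ominus>\<^bsub>M\<^esub> n) = \<zero>\<^bsub>M\<^esub>" by blast
      then have "(a \<otimes> u) \<odot>\<^bsub>M\<^esub> (s \<odot>\<^bsub>M\<^esub> m \<ominus>\<^bsub>M\<^esub> n) = \<zero>\<^bsub>M\<^esub>"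
        using kill[of u "s \<odot>\<^bsub>M\<^esub> \<zero>\<^bsub>M\<^esub> \<ominus>\<^bsub>M\<^esub> n"] absorb[of u s n] zero[of "a \<otimes> u"] ns assms(3) by simp
      then show ?l using au u(1) by blast
    qed
    then show ?thesis
      using ns True assms(2) by (simp add: localization_rel_def)
  qed (auto simp: localization_rel_def)
  then have "localization_frac R M {\<zero>} m \<one> = localization_frac R M {\<zero>} \<zero>\<^bsub>M\<^esub> \<one>"
    by (auto simp: localization_frac_def)
  then show ?thesis
    using assms(2) by (auto simp: contraction_def localize_submodule_def)
qed

end

theorem theorem2p25:
  fixes R :: "('a, 'r) ring_scheme" and M :: "('a, 'b, 'm) module_scheme"
  assumes "noetherian_domain R" and "krull_dim R = 1"
    and "module R M" and "carrier M \<noteq> {\<zero>\<^bsub>M\<^esub>}"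
  shows "(weak_multiplication_module R M \<longrightarrow> top_module R M) \<and>
    ((\<forall>p. primeideal p R \<longrightarrow> finite (Spec_mod_at R M p) \<and> card (Spec_mod_at R M p) \<le> 1) \<and>
       contraction R M {\<zero>\<^bsub>R\<^esub>} {\<zero>\<^bsub>M\<^esub>} \<subseteq> rad_zero R M
     \<longrightarrow> top_module R M)"
proof -
  interpret noetherian_domain R by fact
  interpret module R M by fact
  have dim: "krull_dim R \<le> 1"
    using assms(2) by simp
  show ?thesis
  proof (intro conjI impI)
    assume wm: "weak_multiplication_module R M"
    have P_eq: "P = ideal_smult R M (module_colon R M P)" if "P \<in> Spec_mod R M" for P
      using wm that ideal_smult_module_colon[OF that] by (auto simp: weak_multiplication_module_def)
    show "top_module R M"
    proof (rule top_module_criterion[OF assms(1) dim])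
      fix P Q assume PQ: "P \<in> Spec_mod R M" "Q \<in> Spec_mod R M"
      show "P = Q" if "module_colon R M P = module_colon R M Q"
        using P_eq[OF PQ(1)] P_eq[OF PQ(2)] that by simp
      show "P \<subseteq> Q" if "module_colon R M P = {\<zero>\<^bsub>R\<^esub>}"
      proof -
        have Q: "submodule Q R M"
          by (rule prime_submoduleD(1)[OF PQ(2)])
        have "ideal_smult R M {\<zero>\<^bsub>R\<^esub>} \<subseteq> Q"
          using Q submodule_zero[OF Q] by (auto simp: ideal_smult_def)
        then show ?thesis
          using P_eq[OF PQ(1)] that by simp
      qed
    qed
  next
    assume *: "(\<forall>p. primeideal p R \<longrightarrow> finite (Spec_mod_at R M p) \<and> card (Spec_mod_at R M p) \<le> 1) \<and>
       contraction R M {\<zero>\<^bsub>R\<^esub>} {\<zero>\<^bsub>M\<^esub>} \<subseteq> rad_zero R M"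
    have unique: "P = Q" if PQ: "P \<in> Spec_mod R M" "Q \<in> Spec_mod R M"
        "module_colon R M P = module_colon R M Q" for P Q
    proof -
      have "P \<in> Spec_mod_at R M (module_colon R M P)" "Q \<in> Spec_mod_at R M (module_colon R M P)"
        using PQ by (auto simp: Spec_mod_at_def)
      then show ?thesis
        using * primeideal_module_colon[OF PQ(1)] card_le_Suc0_iff_eq by (metis One_nat_def)
    qed
    show "top_module R M"
    proof (rule top_module_criterion[OF assms(1) dim unique])
      fix P Q assume P: "P \<in> Spec_mod R M" and Q: "Q \<in> Spec_mod R M"
        and colon: "module_colon R M P = {\<zero>\<^bsub>R\<^esub>}"
      define T where "T = {m \<in> carrier M. \<exists>a \<in> carrier R - {\<zero>\<^bsub>R\<^esub>}. a \<odot>\<^bsub>M\<^esub> m \<in> {\<zero>\<^bsub>M\<^esub>}}"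
      have zero_sub: "submodule {\<zero>\<^bsub>M\<^esub>} R M"
        by (rule submoduleI) auto
      have TQ: "T \<subseteq> Q"
        using * torsion_in_contraction[OF domain_axioms] Q by (fastforce simp: T_def rad_zero_def)
      then have "T \<noteq> carrier M"
        using prime_submoduleD(2,3)[OF Q] by blast
      note T = saturation_prime[OF domain_axioms zero_sub T_def this]
      have "P = T"
        using unique[OF P T(1)] colon T(2) by simp
      with TQ show "P \<subseteq> Q" by simp
    qed
  qed
qed

end
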